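(* Let $v\in\mathcal{G}^{N,\mathcal{A}}$ be a game, where $\mathcal{A}$ is a balanced set of coalitions, and let $\mathbf{u}$ be a utility function. Then the $\mathbf{u}$-prenucleolus $N^*_{\mathbf{u}}(v)$ is a singleton if and only if $\operatorname{rank}(X(\mathcal{A}))=|N|$.
   Context: $N$ is a nonempty finite set of players. $\mathcal{A}\subseteq 2^N$ is a family of feasible coalitions with $\emptyset,N\in\mathcal{A}$; $\mathcal{A}^*=\mathcal{A}\setminus\{\emptyset,N\}$. $\mathcal{G}^{N,\mathcal{A}}$ is the set of games, i.e. functions $v:\mathcal{A}\to\mathbb{R}$ with $v(\emptyset)=0$. For $x\in\mathbb{R}^N$, $x(S)=\sum_{i\in S}x_i$; the excess is $e(S,x)=v(S)-x(S)$; $I^*(v)=\{x\in\mathbb{R}^N: x(N)=v(N)\}$ is the set of preimputations. A utility function $\mathbf{u}$ is a family $(u_S)_{S\in\mathcal{A}^*}$ of strictly increasing continuous functions $u_S:\mathbb{R}\to\mathbb{R}$, all having the same range. The $\mathbf{u}$-excess vector $E_{\mathbf{u}}(x)\in\mathbb{R}^{|\mathcal{A}^*|}$ lists the numbers $u_S(e(S,x))$, $S\in\mathcal{A}^*$, in non-increasing order. $\le_L$ is the lexicographic order: $a\le_L b$ if $a=b$ or there is $k$ with $a_k<b_k$ and $a_i=b_i$ for all $i<k$. The $\mathbf{u}$-prenucleolus is $N^*_{\mathbf{u}}(v)=\{x\in I^*(v): E_{\mathbf{u}}(x)\le_L E_{\mathbf{u}}(y)\ \forall y\in I^*(v)\}$.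 A set of coalitions $\mathcal{S}\subseteq\mathcal{A}$ is balanced if there exist weights $\lambda_S>0$ ($S\in\mathcal{S}$) with $\sum_{S\in\mathcal{S}}\lambda_S\chi_S=\chi_N$, where $\chi_T\in\mathbb{R}^N$ is the characteristic vector of $T$. $X(\mathcal{A})$ is the $|\mathcal{A}|\times|N|$ matrix whose rows are the characteristic vectors of the members of $\mathcal{A}$. *)

theory Defs
  imports
    "HOL-Analysis.Analysis"
    "HOL-Library.Countable_Set"
    "HOL-Library.Multiset"
    "Jordan_Normal_Form.DL_Rank"
begin

text \<open>
  Players form a finite set \<open>N :: 'a set\<close>. The space of payoff vectors over \<open>N\<close> is
  \<open>N \<rightarrow>\<^sub>E UNIV\<close>, so that two payoff vectors are equal iff they agree on \<open>N\<close>. A game on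
  \<open>\<A>\<close> is a total function on sets of players; only its values on \<open>\<A>\<close> are ever used.
\<close>

definition feasible_coalitions :: "'a set \<Rightarrow> 'a set set \<Rightarrow> bool" where
  "feasible_coalitions N \<A> \<longleftrightarrow> \<A> \<subseteq> Pow N \<and> {} \<in> \<A> \<and> N \<in> \<A>"

definition proper_coalitions :: "'a set \<Rightarrow> 'a set set \<Rightarrow> 'a set set" where
  "proper_coalitions N \<A> = \<A> - {{}, N}"

definition is_game :: "('a set \<Rightarrow> real) \<Rightarrow> bool" where
  "is_game v \<longleftrightarrow> v {} = 0"

definition excess :: "('a set \<Rightarrow> real) \<Rightarrow> 'a set \<Rightarrow> ('a \<Rightarrow> real) \<Rightarrow> real" where
  "excess v S x = v S - (\<Sum>i\<in>S. x i)"

definition preimputations :: "'a set \<Rightarrow> ('a set \<Rightarrow> real) \<Rightarrow> ('a \<Rightarrow> real) set" where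
  "preimputations N v = {x \<in> N \<rightarrow>\<^sub>E UNIV. (\<Sum>i\<in>N. x i) = v N}"

definition utility_function :: "'a set \<Rightarrow> 'a set set \<Rightarrow> ('a set \<Rightarrow> real \<Rightarrow> real) \<Rightarrow> bool" where
  "utility_function N \<A> u \<longleftrightarrow>
     (\<forall>S\<in>proper_coalitions N \<A>. strict_mono (u S) \<and> continuous_on UNIV (u S)) \<and>
     (\<forall>S\<in>proper_coalitions N \<A>. \<forall>T\<in>proper_coalitions N \<A>. range (u S) = range (u T))"

text \<open>
  The excesses are collected in a multiset, so equal values of different coalitions are kept and
  the list has length \<open>card (proper_coalitions N \<A>)\<close>; \<open>rev\<close> makes it non-increasing.
\<close>

definition excess_vector ::
    "'a set \<Rightarrow> 'a set set \<Rightarrow> ('a set \<Rightarrow> real \<Rightarrow> real) \<Rightarrow> ('a set \<Rightarrow> real) \<Rightarrow> ('a \<Rightarrow> real) \<Rightarrow> real list" where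
  "excess_vector N \<A> u v x =
     rev (sorted_list_of_multiset
       (image_mset (\<lambda>S. u S (excess v S x)) (mset_set (proper_coalitions N \<A>))))"

text \<open>Used only for lists of equal length.\<close>

definition lex_le :: "real list \<Rightarrow> real list \<Rightarrow> bool" (infix "\<le>\<^sub>L" 50) where
  "a \<le>\<^sub>L b \<longleftrightarrow> a = b \<or> (\<exists>k<length a. a ! k < b ! k \<and> (\<forall>i<k. a ! i = b ! i))"

definition prenucleolus ::
    "'a set \<Rightarrow> 'a set set \<Rightarrow> ('a set \<Rightarrow> real \<Rightarrow> real) \<Rightarrow> ('a set \<Rightarrow> real) \<Rightarrow> ('a \<Rightarrow> real) set" where
  "prenucleolus N \<A> u v =
     {x \<in> preimputations N v. \<forall>y\<in>preimputations N v.
        excess_vector N \<A> u v x \<le>\<^sub>L excess_vector N \<A> u v y}"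

definition balanced :: "'a set \<Rightarrow> 'a set set \<Rightarrow> bool" where
  "balanced N \<S> \<longleftrightarrow>
     (\<exists>w :: 'a set \<Rightarrow> real. (\<forall>S\<in>\<S>. w S > 0) \<and>
        (\<forall>i\<in>N. (\<Sum>S\<in>\<S>. w S * indicat_real S i) = indicat_real N i))"

text \<open>
  The matrix with one row per coalition and one column per player, both in the order given by
  \<open>from_nat_into\<close>. For a finite set \<open>B\<close>, \<open>from_nat_into B\<close> restricts to a bijection from
  \<open>{..<card B}\<close> onto \<open>B\<close>; the rank does not depend on which bijection is used.
\<close>

definition coalition_matrix :: "'a set \<Rightarrow> 'a set set \<Rightarrow> real mat" where
  "coalition_matrix N \<A> =
     mat (card \<A>) (card N)
       (\<lambda>(r, c). indicat_real (from_nat_into \<A> r) (from_nat_into N c))"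

end

theory Submission
  imports Defs
begin

text \<open>
  Full column rank of the coalition matrix means that its kernel is trivial: a payoff change
  \<open>d\<close> that adds nothing to the total of any feasible coalition is zero
  (\<open>rank_coalition_matrix_eq_card_iff\<close>). A change \<open>d\<close> in the kernel does not move any
  excess and preserves \<open>x(N)\<close>, so it maps the prenucleolus to itself
  (\<open>prenucleolus_shift\<close>). A one-point prenucleolus therefore forces the kernel to be trivial.

  For the converse, uniqueness comes from quasi-convexity. Excesses are affine in the payoff
  vector and every utility is strictly increasing, so at the midpoint of two payoff vectors the
  utility of a coalition's excess is below the larger of the two end values wherever these differ,
  and equal to both where they agree. At the largest value that one of the two end vectors takes on
  a coalition where they differ, the midpoint is lexicographically below one of them
  (\<open>midpoint_lex_improves\<close>). So two members of the prenucleolus give every feasible coalition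
  the same total (\<open>prenucleolus_same_coalition_payoffs\<close>), and a trivial kernel identifies them.

  For existence, only preimputations none of whose excess utilities exceed the maximal one \<open>M\<close> at
  some fixed preimputation can compete. As all utilities have the same range, \<open>M\<close> is a value of
  each of them, so each excess of a competitor is bounded above and each coalition total is bounded
  below. Balancedness expresses \<open>x(N)\<close> as a positive combination of all the coalition totals;
  since \<open>x(N)\<close> is fixed, the totals are bounded above as well
  (\<open>coalition_payoffs_bounded_if_balanced\<close>). A trivial kernel turns bounded totals into bounded
  payoffs (\<open>payoff_bound_if_separates\<close>), hence the competitors form a compact set, on which the
  entries of the sorted vector, being lower semicontinuous, can be minimised one after the other
  (\<open>lex_min_on_compact\<close>).
\<close>

section \<open>Sorted value vectors and the lexicographic order\<close>

definition descending_values :: "('s \<Rightarrow> real) \<Rightarrow> 's set \<Rightarrow> real list" where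
  "descending_values f A = rev (sorted_list_of_multiset (image_mset f (mset_set A)))"

lemma nth_antitone_list_iff:
  fixes xs :: "'b::linorder list"
  assumes "sorted_wrt (\<ge>) xs" and up: "\<And>a b. P a \<Longrightarrow> a \<le> b \<Longrightarrow> P b" and "k < length xs"
  shows "P (xs ! k) \<longleftrightarrow> k < length (filter P xs)"
  using assms(1,3)
proof (induction xs arbitrary: k)
  case (Cons a xs)
  show ?case
  proof (cases "P a")
    case True
    then show ?thesis using Cons by (cases k) auto
  next
    case False
    then have none: "\<not> P b" if "b \<in> set (a # xs)" for b
      using that Cons.prems(1) up by auto
    then have "filter P (a # xs) = []" by (auto simp: filter_empty_conv)
    then show ?thesis using none[OF nth_mem[OF Cons.prems(2)]] by simp
  qed
qed simp

lemma length_descending_values [simp]: "length (descending_values f A) = card A"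
  unfolding descending_values_def length_rev by (metis mset_sorted_list_of_multiset size_image_mset size_mset size_mset_set)

text \<open>
  All comparisons of sorted vectors go through this counting criterion: it replaces the position
  of an entry by the number of coalitions whose value passes a threshold. The predicate is \<open>c <\<close>
  or \<open>c \<le>\<close> in the applications.
\<close>

lemma nth_descending_values_iff:
  assumes "finite A" and up: "\<And>a b. P a \<Longrightarrow> a \<le> b \<Longrightarrow> P b" and "k < card A"
  shows "P (descending_values f A ! k) \<longleftrightarrow> k < card {S \<in> A. P (f S)}"
proof -
  let ?xs = "descending_values f A"
  have "sorted_wrt (\<ge>) ?xs"
    by (simp add: descending_values_def sorted_wrt_rev)
  then have "P (?xs ! k) \<longleftrightarrow> k < length (filter P ?xs)"
    using assms by (intro nth_antitone_list_iff) auto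
  also have "length (filter P ?xs) = size (filter_mset P (mset ?xs))"
    by (metis mset_filter size_mset)
  also have "\<dots> = card {S \<in> A. P (f S)}"
    using \<open>finite A\<close> by (simp add: descending_values_def filter_mset_image_mset filter_mset_mset_set)
  finally show ?thesis .
qed

lemma not_lex_le_if_first_difference:
  assumes "\<forall>i<k. a ! i = b ! i" and "b ! k < a ! k"
  shows "\<not> a \<le>\<^sub>L b"
proof
  assume "a \<le>\<^sub>L b"
  then obtain l where l: "a ! l < b ! l" "\<forall>i<l. a ! i = b ! i"
    using assms(2) by (auto simp: lex_le_def)
  then show False
    using assms by (cases l k rule: linorder_cases) auto
qed

text \<open>
  Above \<open>\<theta>\<close> the two families coincide, while \<open>T\<close> reaches \<open>\<theta>\<close> under \<open>f\<close> but not under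
  \<open>h\<close>, so fewer values of \<open>h\<close> reach \<open>\<theta>\<close>. With \<open>k\<close> the number of coalitions reaching
  \<open>\<theta>\<close> under \<open>h\<close>, the sorted vectors agree before position \<open>k\<close>, and there \<open>f\<close> still
  has an entry of at least \<open>\<theta>\<close> whereas \<open>h\<close> has dropped below it.
\<close>

lemma descending_values_not_lex_le:
  assumes "finite A"
    and above: "\<And>S. S \<in> A \<Longrightarrow> \<theta> < f S \<or> \<theta> < h S \<Longrightarrow> f S = h S"
    and at: "\<And>S. S \<in> A \<Longrightarrow> \<theta> \<le> h S \<Longrightarrow> \<theta> \<le> f S"
    and T: "T \<in> A" "h T < \<theta>" "\<theta> \<le> f T"
  shows "\<not> descending_values f A \<le>\<^sub>L descending_values h A"
proof -
  let ?k = "card {S \<in> A. \<theta> \<le> h S}"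
  have less: "?k < card {S \<in> A. \<theta> \<le> f S}"
    using \<open>finite A\<close> at T by (intro psubset_card_mono) (auto simp: not_le[symmetric])
  also have "\<dots> \<le> card A" using \<open>finite A\<close> by (intro card_mono) auto
  finally have k: "?k < card A" .
  have nth: "c < descending_values g A ! i \<longleftrightarrow> i < card {S \<in> A. c < g S}"
    if "i < card A" for g c i
    using nth_descending_values_iff[OF \<open>finite A\<close>, of "\<lambda>a. c < a"] that by auto
  have nth': "c \<le> descending_values g A ! i \<longleftrightarrow> i < card {S \<in> A. c \<le> g S}"
    if "i < card A" for g c i
    using nth_descending_values_iff[OF \<open>finite A\<close>, of "\<lambda>a. c \<le> a"] that by auto
  have "descending_values f A ! i = descending_values h A ! i" if "i < ?k" for i
  proof -
    have i: "i < card A" using that k by simp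
    have "c < descending_values f A ! i \<longleftrightarrow> c < descending_values h A ! i" for c
    proof (cases "\<theta> \<le> c")
      case True
      then have "c < f S \<longleftrightarrow> c < h S" if "S \<in> A" for S
        using above[OF that] by linarith
      then have "{S \<in> A. c < f S} = {S \<in> A. c < h S}" by blast
      then show ?thesis using nth[OF i] by simp
    next
      case False
      have "\<theta> \<le> descending_values f A ! i" "\<theta> \<le> descending_values h A ! i"
        using nth'[OF i] that less by auto
      then show ?thesis using False by simp
    qed
    then show ?thesis by (meson linorder_neqE_linordered_idom order_less_irrefl)
  qed
  moreover have "descending_values h A ! ?k < descending_values f A ! ?k"
    using nth'[OF k, of \<theta> h] nth'[OF k, of \<theta> f] less by simp
  ultimately show ?thesis by (intro not_lex_le_if_first_difference[of ?k] allI impI)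
qed

text \<open>
  The largest value \<open>\<theta>\<close> taken where \<open>f\<close> and \<open>g\<close> differ is a threshold as in the previous
  lemma: above it \<open>f\<close>, \<open>g\<close> and \<open>h\<close> agree, and whichever of \<open>f\<close> and \<open>g\<close> attains
  \<open>\<theta>\<close> there loses that coalition in \<open>h\<close>.
\<close>

lemma midpoint_lex_improves:
  assumes "finite A"
    and same: "\<And>S. S \<in> A \<Longrightarrow> f S = g S \<Longrightarrow> h S = f S"
    and differ: "\<And>S. S \<in> A \<Longrightarrow> f S \<noteq> g S \<Longrightarrow> h S < max (f S) (g S)"
    and ex: "\<exists>S\<in>A. f S \<noteq> g S"
  shows "\<not> descending_values f A \<le>\<^sub>L descending_values h A \<or>
    \<not> descending_values g A \<le>\<^sub>L descending_values h A"
proof -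
  let ?D = "{S \<in> A. f S \<noteq> g S}"
  define \<theta> where "\<theta> = Max ((\<lambda>S. max (f S) (g S)) ` ?D)"
  have "finite ?D" "?D \<noteq> {}" using \<open>finite A\<close> ex by auto
  then have le: "max (f S) (g S) \<le> \<theta>" if "S \<in> ?D" for S
    unfolding \<theta>_def using that by (intro Max_ge) auto
  have "\<theta> \<in> (\<lambda>S. max (f S) (g S)) ` ?D"
    unfolding \<theta>_def using \<open>finite ?D\<close> \<open>?D \<noteq> {}\<close> by (intro Max_in) auto
  then obtain T where T: "T \<in> A" "f T \<noteq> g T" "max (f T) (g T) = \<theta>" by auto
  have hT: "h T < \<theta>" using differ[OF T(1,2)] T(3) by simp
  have D: "f S < \<theta> \<and> h S < \<theta> \<or> f S = \<theta> \<and> h S < \<theta>" "g S < \<theta> \<and> h S < \<theta> \<or> g S = \<theta> \<and> h S < \<theta>"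
    if "S \<in> A" "f S \<noteq> g S" for S
    using le[of S] differ[OF that] that by auto
  show ?thesis
  proof (cases "f T = \<theta>")
    case True
    have "\<not> descending_values f A \<le>\<^sub>L descending_values h A"
      using T hT True D(1) same
      by (intro descending_values_not_lex_le[OF \<open>finite A\<close>, of \<theta>]) (force+)
    then show ?thesis ..
  next
    case False
    then have gT: "g T = \<theta>" using T(3) by (auto simp: max_def split: if_splits)
    have "\<not> descending_values g A \<le>\<^sub>L descending_values h A"
      using T hT gT D(2) same
      by (intro descending_values_not_lex_le[OF \<open>finite A\<close>, of \<theta>]) (force+)
    then show ?thesis ..
  qed
qed

section \<open>Lexicographic minimisation on compact sets\<close>

text \<open>
  Weierstrass' theorem for lower semicontinuous functions: the sublevel sets at the values of the
  function have the finite intersection property.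
\<close>

lemma attains_min_if_sublevels_closed:
  fixes f :: "'x::topological_space \<Rightarrow> real"
  assumes "compact K" "K \<noteq> {}" and closed: "\<And>c. closed {x. f x \<le> c}"
  shows "\<exists>x\<in>K. \<forall>y\<in>K. f x \<le> f y"
proof -
  have "K \<inter> (\<Inter>y\<in>K. {x. f x \<le> f y}) \<noteq> {}"
  proof (rule compact_imp_fip_image[OF \<open>compact K\<close>])
    fix I assume I: "finite I" "I \<subseteq> K"
    show "K \<inter> (\<Inter>y\<in>I. {x. f x \<le> f y}) \<noteq> {}"
    proof (cases "I = {}")
      case False
      then obtain x where "x \<in> I" "\<forall>y\<in>I. f x \<le> f y"
        using arg_min_if_finite(1)[OF I(1) False, of f] arg_min_least[OF I(1) False, of _ f] by blast
      then show ?thesis using I(2) by auto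
    qed (use \<open>K \<noteq> {}\<close> in simp)
  qed (rule closed)
  then show ?thesis by auto
qed

text \<open>
  The entry at position \<open>k\<close> is at most \<open>c\<close> iff, up to a set \<open>T\<close> of at most \<open>k\<close>
  exceptions, all values are at most \<open>c\<close>. This makes the sublevel set a finite union of
  intersections of closed sets.
\<close>

lemma closed_sublevel_descending_values:
  fixes f :: "'x::topological_space \<Rightarrow> 's \<Rightarrow> real"
  assumes "finite A" and cont: "\<And>S. S \<in> A \<Longrightarrow> continuous_on UNIV (\<lambda>x. f x S)" and "k < card A"
  shows "closed {x. descending_values (f x) A ! k \<le> c}"
proof -
  have iff: "descending_values (f x) A ! k \<le> c \<longleftrightarrow> (\<exists>T\<in>{T. T \<subseteq> A \<and> card T \<le> k}. \<forall>S\<in>A - T. f x S \<le> c)"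
    for x
  proof -
    have "c < descending_values (f x) A ! k \<longleftrightarrow> k < card {S \<in> A. c < f x S}"
      by (rule nth_descending_values_iff[OF \<open>finite A\<close> order_less_le_trans \<open>k < card A\<close>])
    then have "descending_values (f x) A ! k \<le> c \<longleftrightarrow> card {S \<in> A. c < f x S} \<le> k"
      by (simp only: not_less[symmetric] simp_thms)
    also have "\<dots> \<longleftrightarrow> (\<exists>T\<in>{T. T \<subseteq> A \<and> card T \<le> k}. \<forall>S\<in>A - T. f x S \<le> c)"
    proof
      assume "card {S \<in> A. c < f x S} \<le> k"
      then show "\<exists>T\<in>{T. T \<subseteq> A \<and> card T \<le> k}. \<forall>S\<in>A - T. f x S \<le> c"
        by (intro bexI[of _ "{S \<in> A. c < f x S}"]) auto
    next
      assume "\<exists>T\<in>{T. T \<subseteq> A \<and> card T \<le> k}. \<forall>S\<in>A - T. f x S \<le> c"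
      then obtain T where T: "T \<subseteq> A" "card T \<le> k" "\<forall>S\<in>A - T. f x S \<le> c" by auto
      then have "card {S \<in> A. c < f x S} \<le> card T"
        using finite_subset[OF T(1) \<open>finite A\<close>] by (intro card_mono) (auto simp: not_le[symmetric])
      then show "card {S \<in> A. c < f x S} \<le> k" using T(2) by simp
    qed
    finally show ?thesis .
  qed
  have "{x. descending_values (f x) A ! k \<le> c} =
      (\<Union>T\<in>{T. T \<subseteq> A \<and> card T \<le> k}. \<Inter>S\<in>A - T. {x. f x S \<le> c})"
    unfolding iff by blast
  also have "closed \<dots>"
  proof (intro closed_UN ballI closed_INT)
    show "closed {x. f x S \<le> c}" if "S \<in> A - T" for T S
      using that by (intro closed_Collect_le[OF cont continuous_on_const]) simp
  qed (use \<open>finite A\<close> in simp)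
  finally show ?thesis .
qed

text \<open>
  Minimise the entries successively, each over the set of minimisers of the preceding ones. These
  sets stay compact and nonempty.
\<close>

lemma lex_min_on_compact:
  fixes E :: "'x::topological_space \<Rightarrow> real list"
  assumes "compact K" "K \<noteq> {}" and length: "\<And>x. length (E x) = n"
    and closed: "\<And>k c. k < n \<Longrightarrow> closed {x. E x ! k \<le> c}"
  shows "\<exists>x\<in>K. \<forall>y\<in>K. E x \<le>\<^sub>L E y"
proof -
  \<comment> \<open>\<open>M\<close> is the set of points whose first \<open>m\<close> entries are lexicographically minimal.\<close>
  have "\<exists>M\<subseteq>K. compact M \<and> M \<noteq> {} \<and> (\<forall>x\<in>M. \<forall>y\<in>K.
      (\<exists>k<m. E x ! k < E y ! k \<and> (\<forall>i<k. E x ! i = E y ! i)) \<or>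
      y \<in> M \<and> (\<forall>i<m. E x ! i = E y ! i))" if "m \<le> n" for m
    using that
  proof (induction m)
    case 0
    then show ?case using assms(1,2) by auto
  next
    case (Suc m)
    obtain M where M: "M \<subseteq> K" "compact M" "M \<noteq> {}"
      and lex: "\<forall>x\<in>M. \<forall>y\<in>K.
        (\<exists>k<m. E x ! k < E y ! k \<and> (\<forall>i<k. E x ! i = E y ! i)) \<or>
        y \<in> M \<and> (\<forall>i<m. E x ! i = E y ! i)"
      using Suc.IH Suc.prems by auto
    obtain z where z: "z \<in> M" "\<forall>y\<in>M. E z ! m \<le> E y ! m"
      using attains_min_if_sublevels_closed[OF M(2,3), of "\<lambda>x. E x ! m"] closed[of m] Suc.prems
      by auto
    let ?M' = "M \<inter> {x. E x ! m \<le> E z ! m}"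
    have "compact ?M'" using M(2) closed Suc.prems by (intro compact_Int_closed) auto
    moreover have "(\<exists>k<Suc m. E x ! k < E y ! k \<and> (\<forall>i<k. E x ! i = E y ! i)) \<or>
        y \<in> ?M' \<and> (\<forall>i<Suc m. E x ! i = E y ! i)" if "x \<in> ?M'" "y \<in> K" for x y
    proof -
      have xm: "E x ! m = E z ! m" using z(2) that(1) by force
      from that have "(\<exists>k<m. E x ! k < E y ! k \<and> (\<forall>i<k. E x ! i = E y ! i)) \<or>
          y \<in> M \<and> (\<forall>i<m. E x ! i = E y ! i)"
        using lex by blast
      then show ?thesis
      proof
        assume y: "y \<in> M \<and> (\<forall>i<m. E x ! i = E y ! i)"
        then have "E x ! m \<le> E y ! m" using z(2) xm by simp
        then show ?thesis using y xm less_Suc_eq by (cases "E x ! m = E y ! m") auto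
      qed (auto intro: less_SucI)
    qed
    ultimately show ?case using z(1) M(1) by (intro exI[of _ ?M']) auto
  qed
  from this[OF order_refl] obtain M where M: "M \<subseteq> K" "M \<noteq> {}"
    and lex: "\<forall>x\<in>M. \<forall>y\<in>K.
        (\<exists>k<n. E x ! k < E y ! k \<and> (\<forall>i<k. E x ! i = E y ! i)) \<or>
        y \<in> M \<and> (\<forall>i<n. E x ! i = E y ! i)"
    by auto
  obtain x where "x \<in> M" using M(2) by auto
  have "E x \<le>\<^sub>L E y" if "y \<in> K" for y
    using bspec[OF bspec[OF lex \<open>x \<in> M\<close>] that] length unfolding lex_le_def by (auto simp: list_eq_iff_nth_eq)
  then show ?thesis using \<open>x \<in> M\<close> M(1) by auto
qed


section \<open>Payoffs determined by the coalitions\<close>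

text \<open>
  Triviality of the kernel of the coalition matrix, without enumerations of players and coalitions.
  The vector \<open>d\<close> is a total function, so it can vanish only as far as \<open>N\<close> reaches.
\<close>

definition separates_payoffs :: "'a set \<Rightarrow> 'a set set \<Rightarrow> bool" where
  "separates_payoffs N \<A> \<longleftrightarrow>
     (\<forall>d :: 'a \<Rightarrow> real. (\<forall>S\<in>\<A>. sum d S = 0) \<longrightarrow> (\<forall>i\<in>N. d i = 0))"

text \<open>
  The rank is the dimension of the span of the \<^emph>\<open>set\<close> of columns, and linear independence is
  likewise a property of that set. A repeated column escapes it, so both directions must first show
  that the columns are distinct.
\<close>

lemma rank_eq_dim_col_iff_trivial_kernel:
  fixes B :: "'f::field mat"
  assumes B: "B \<in> carrier_mat n nc"
  shows "vec_space.rank n B = nc \<longleftrightarrow>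
    (\<forall>w\<in>carrier_vec nc. B *\<^sub>v w = 0\<^sub>v n \<longrightarrow> w = 0\<^sub>v nc)"
proof
  interpret vec_space "TYPE('f)" n .
  assume rank: "rank B = nc"
  have "distinct (cols B)"
  proof (rule ccontr)
    assume "\<not> distinct (cols B)"
    then have "card (set (cols B)) < nc"
      using B card_distinct[of "cols B"] card_length[of "cols B"] by fastforce
    moreover obtain S where S: "maximal S (\<lambda>T. T \<subseteq> set (cols B) \<and> lin_indpt T)"
      using maximal_exists_superset[of "set (cols B)" "\<lambda>T. T \<subseteq> set (cols B) \<and> lin_indpt T" "{}"]
      by (auto simp: lin_dep_def)
    moreover have "card S \<le> card (set (cols B))"
      using S by (intro card_mono) (auto simp: maximal_def)
    ultimately show False using rank rank_card_indpt[OF B S] by simp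
  qed
  then show "\<forall>w\<in>carrier_vec nc. B *\<^sub>v w = 0\<^sub>v n \<longrightarrow> w = 0\<^sub>v nc"
    using lin_depI[OF B] full_rank_lin_indpt[OF B rank] by blast
next
  interpret vec_space "TYPE('f)" n .
  assume ker: "\<forall>w\<in>carrier_vec nc. B *\<^sub>v w = 0\<^sub>v n \<longrightarrow> w = 0\<^sub>v nc"
  have "distinct (cols B)"
  proof (rule ccontr)
    assume "\<not> distinct (cols B)"
    then obtain i j where ij: "i < nc" "j < nc" "i \<noteq> j" "col B i = col B j"
      using B by (auto simp: distinct_conv_nth)
    have unit: "B *\<^sub>v unit_vec nc l = col B l" if "l < nc" for l
      using B that by (intro eq_vecI) auto
    \<comment> \<open>The difference of two unit vectors at equal columns lies in the kernel.\<close>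
    let ?w = "unit_vec nc i - unit_vec nc j :: 'f vec"
    have "B *\<^sub>v ?w = B *\<^sub>v unit_vec nc i - B *\<^sub>v unit_vec nc j"
      using B by (intro mult_minus_distrib_mat_vec) auto
    also have "\<dots> = col B i - col B j"
      using unit ij(1,2) by simp
    also have "\<dots> = 0\<^sub>v n" using B ij(4) by auto
    finally have "?w = 0\<^sub>v nc" using ker by auto
    then have "vec_index ?w i = 0" using ij(1) by simp
    then show False using ij by simp
  qed
  then show "rank B = nc"
    using lin_indpt_full_rank[OF B] lin_depE[OF B] ker by metis
qed

lemma sum_indicator_times_subset:
  assumes "finite N" "S \<subseteq> N"
  shows "(\<Sum>i\<in>N. indicat_real S i * d i) = sum d S"
  using assms by (intro sum.mono_neutral_cong_right) auto

lemma rank_coalition_matrix_eq_card_iff: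
  assumes "finite N" "finite \<A>" "\<A> \<subseteq> Pow N"
  shows "vec_space.rank (card \<A>) (coalition_matrix N \<A>) = card N \<longleftrightarrow> separates_payoffs N \<A>"
proof -
  let ?X = "coalition_matrix N \<A>"
  have X: "?X \<in> carrier_mat (card \<A>) (card N)" by (simp add: coalition_matrix_def)
  have entry: "vec_index (?X *\<^sub>v w) r = sum d (from_nat_into \<A> r)"
    if "r < card \<A>" and w: "w \<in> carrier_vec (card N)"
      and d: "\<And>c. c < card N \<Longrightarrow> vec_index w c = d (from_nat_into N c)" for w d r
  proof -
    let ?S = "from_nat_into \<A> r"
    have "?S \<in> \<A>" using \<open>r < card \<A>\<close> by (intro from_nat_into) auto
    then have "?S \<subseteq> N" using assms by auto
    have "vec_index (?X *\<^sub>v w) r =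
        (\<Sum>c<card N. indicat_real ?S (from_nat_into N c) * d (from_nat_into N c))"
      using \<open>r < card \<A>\<close> w d
      by (auto simp: coalition_matrix_def scalar_prod_def lessThan_atLeast0 intro!: sum.cong)
    also have "\<dots> = (\<Sum>i\<in>N. indicat_real ?S i * d i)"
      by (rule sum.card_from_nat_into)
    also have "\<dots> = sum d ?S"
      by (rule sum_indicator_times_subset[OF \<open>finite N\<close> \<open>?S \<subseteq> N\<close>])
    finally show ?thesis .
  qed
  have rows: "from_nat_into \<A> ` {..<card \<A>} = \<A>" and cols: "from_nat_into N ` {..<card N} = N"
    using bij_betw_from_nat_into_finite assms(1,2) by (auto simp: bij_betw_def)
  have inj: "inj_on (from_nat_into N) {..<card N}"
    using bij_betw_from_nat_into_finite assms(1) by (auto simp: bij_betw_def)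
  \<comment> \<open>A vector \<open>w\<close> and a payoff change \<open>d\<close> represent each other when they agree along the
    enumeration of the players.\<close>
  have kernel: "?X *\<^sub>v w = 0\<^sub>v (card \<A>) \<longleftrightarrow> (\<forall>S\<in>\<A>. sum d S = 0)"
    if w: "w \<in> carrier_vec (card N)"
      and d: "\<And>c. c < card N \<Longrightarrow> vec_index w c = d (from_nat_into N c)" for w d
  proof -
    have "?X *\<^sub>v w = 0\<^sub>v (card \<A>) \<longleftrightarrow> (\<forall>r<card \<A>. vec_index (?X *\<^sub>v w) r = 0)"
      using X by (auto simp: vec_eq_iff)
    also have "\<dots> \<longleftrightarrow> (\<forall>r\<in>{..<card \<A>}. sum d (from_nat_into \<A> r) = 0)"
      using entry[OF _ w d] by auto
    also have "\<dots> \<longleftrightarrow> (\<forall>S\<in>from_nat_into \<A> ` {..<card \<A>}. sum d S = 0)" by simp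
    finally show ?thesis unfolding rows .
  qed
  have zero: "w = 0\<^sub>v (card N) \<longleftrightarrow> (\<forall>i\<in>N. d i = 0)"
    if w: "w \<in> carrier_vec (card N)"
      and d: "\<And>c. c < card N \<Longrightarrow> vec_index w c = d (from_nat_into N c)" for w and d :: "'a \<Rightarrow> real"
  proof -
    have "w = 0\<^sub>v (card N) \<longleftrightarrow> (\<forall>c\<in>{..<card N}. d (from_nat_into N c) = 0)"
      using w d by (auto simp: vec_eq_iff)
    also have "\<dots> \<longleftrightarrow> (\<forall>i\<in>from_nat_into N ` {..<card N}. d i = 0)" by simp
    finally show ?thesis unfolding cols .
  qed
  have "(\<forall>w\<in>carrier_vec (card N). ?X *\<^sub>v w = 0\<^sub>v (card \<A>) \<longrightarrow> w = 0\<^sub>v (card N)) \<longleftrightarrow>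
      separates_payoffs N \<A>"
  proof
    assume *: "\<forall>w\<in>carrier_vec (card N). ?X *\<^sub>v w = 0\<^sub>v (card \<A>) \<longrightarrow> w = 0\<^sub>v (card N)"
    show "separates_payoffs N \<A>"
      unfolding separates_payoffs_def
    proof (intro allI impI)
      fix d :: "'a \<Rightarrow> real" assume d: "\<forall>S\<in>\<A>. sum d S = 0"
      let ?w = "vec (card N) (\<lambda>c. d (from_nat_into N c))"
      show "\<forall>i\<in>N. d i = 0"
        using * kernel[of ?w d] zero[of ?w d] d by auto
    qed
  next
    assume sep: "separates_payoffs N \<A>"
    show "\<forall>w\<in>carrier_vec (card N). ?X *\<^sub>v w = 0\<^sub>v (card \<A>) \<longrightarrow> w = 0\<^sub>v (card N)"
    proof (intro ballI impI)
      fix w assume w: "w \<in> carrier_vec (card N)" "?X *\<^sub>v w = 0\<^sub>v (card \<A>)"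
      define d where "d i = vec_index w (the_inv_into {..<card N} (from_nat_into N) i)" for i
      have d: "vec_index w c = d (from_nat_into N c)" if "c < card N" for c
        unfolding d_def using the_inv_into_f_f[OF inj] that by simp
      show "w = 0\<^sub>v (card N)"
        using kernel[OF w(1) d] zero[OF w(1) d] w(2) sep by (auto simp: separates_payoffs_def)
    qed
  qed
  then show ?thesis using rank_eq_dim_col_iff_trivial_kernel[OF X] by simp
qed

section \<open>Boundedness\<close>

text \<open>
  Tychonoff's theorem for extensional functions in the topology of pointwise convergence on the
  full function type: outside \<open>I\<close> the factor is the one-point set \<open>{undefined}\<close>.
\<close>

lemma compact_PiE_fun:
  fixes B :: "'i \<Rightarrow> 'b::topological_space set"
  assumes "\<And>i. i \<in> I \<Longrightarrow> compact (B i)"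
  shows "compact (Pi\<^sub>E I B)"
proof -
  have "Pi\<^sub>E I B = Pi\<^sub>E UNIV (\<lambda>i. if i \<in> I then B i else {undefined})"
    by (auto simp: PiE_iff extensional_def split: if_splits)
  moreover have "compactin (product_topology (\<lambda>i. euclidean) UNIV)
      (Pi\<^sub>E UNIV (\<lambda>i. if i \<in> I then B i else {undefined}))"
    using assms by (simp add: compactin_PiE)
  ultimately show ?thesis by (simp add: euclidean_product_topology)
qed

lemma continuous_on_coordinate_sum: "continuous_on UNIV (\<lambda>x :: 'a \<Rightarrow> real. sum x S)"
  by (intro continuous_on_sum continuous_on_product_coordinates)

text \<open>
  With a trivial kernel the right-hand side is a norm on payoffs, and all norms in finite dimension
  are equivalent: \<open>\<delta>\<close> is its minimum on the unit sphere \<open>?Q\<close> of the maximum norm, and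
  scaling extends the inequality to all payoffs.
\<close>

lemma payoff_bound_if_separates:
  assumes "finite N" "finite \<A>" "\<A> \<subseteq> Pow N" and sep: "separates_payoffs N \<A>"
  shows "\<exists>\<delta>>0. \<forall>x :: 'a \<Rightarrow> real. \<forall>i\<in>N. \<delta> * \<bar>x i\<bar> \<le> (\<Sum>S\<in>\<A>. \<bar>sum x S\<bar>)"
proof (cases "N = {}")
  case True
  then show ?thesis by (intro exI[of _ 1]) auto
next
  case False
  define g :: "('a \<Rightarrow> real) \<Rightarrow> real" where "g x = (\<Sum>S\<in>\<A>. \<bar>sum x S\<bar>)" for x
  let ?Q = "(N \<rightarrow>\<^sub>E {-1..1}) \<inter> (\<Union>i\<in>N. {x :: 'a \<Rightarrow> real. \<bar>x i\<bar> = 1})"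
  have "compact ?Q"
    using \<open>finite N\<close>
    by (intro compact_Int_closed compact_PiE_fun closed_UN ballI closed_Collect_eq
        continuous_on_rabs continuous_on_const continuous_on_product_coordinates) auto
  moreover have "(\<lambda>i\<in>N. 1) \<in> ?Q" using False by auto
  then have "?Q \<noteq> {}" by blast
  moreover have "continuous_on UNIV g"
    unfolding g_def
    by (intro continuous_on_sum[of \<A>] continuous_on_rabs continuous_on_coordinate_sum)
  then have "continuous_on ?Q g" by (rule continuous_on_subset) simp
  ultimately obtain q where q: "q \<in> ?Q" "\<And>x. x \<in> ?Q \<Longrightarrow> g q \<le> g x"
    using continuous_attains_inf[of ?Q g] by blast
  have "g q > 0"
  proof (rule ccontr)
    assume "\<not> g q > 0"
    moreover have "0 \<le> g q" unfolding g_def by (intro sum_nonneg) simp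
    ultimately have "g q = 0" by simp
    then have "\<forall>S\<in>\<A>. sum q S = 0"
      using \<open>finite \<A>\<close> by (simp add: g_def sum_nonneg_eq_0_iff)
    then show False using sep q(1) unfolding separates_payoffs_def by fastforce
  qed
  moreover have "g q * \<bar>x i\<bar> \<le> g x" if "i \<in> N" for x i
  proof -
    define m where "m = Max ((\<lambda>i. \<bar>x i\<bar>) ` N)"
    have le: "\<bar>x j\<bar> \<le> m" if "j \<in> N" for j
      unfolding m_def using that \<open>finite N\<close> by (intro Max_ge) auto
    have "m \<in> (\<lambda>i. \<bar>x i\<bar>) ` N" unfolding m_def using False \<open>finite N\<close> by (intro Max_in) auto
    then obtain j where j: "j \<in> N" "\<bar>x j\<bar> = m" by auto
    show ?thesis
    proof (cases "m = 0")
      case True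
      then show ?thesis using le[OF \<open>i \<in> N\<close>] by (simp add: g_def sum_nonneg)
    next
      case False
      then have m: "m > 0" using j(2) by auto
      let ?y = "\<lambda>i\<in>N. x i / m"
      have "?y l \<in> {-1..1}" if "l \<in> N" for l
        using le[OF that] m that by (auto simp: abs_le_iff field_simps)
      then have "?y \<in> N \<rightarrow>\<^sub>E {-1..1}" by (intro PiE_I) auto
      moreover have "\<bar>?y j\<bar> = 1" using j m by simp
      ultimately have "?y \<in> ?Q" using j(1) by blast
      have scaled: "sum ?y S = sum x S / m" if "S \<in> \<A>" for S
      proof -
        have "sum ?y S = (\<Sum>i\<in>S. x i / m)" using that assms(3) by (intro sum.cong) auto
        then show ?thesis by (simp add: sum_divide_distrib)
      qed
      have "g ?y = (\<Sum>S\<in>\<A>. \<bar>sum x S\<bar> / m)"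
        unfolding g_def
      proof (rule sum.cong)
        show "\<bar>sum ?y S\<bar> = \<bar>sum x S\<bar> / m" if "S \<in> \<A>" for S
          using m by (simp only: scaled[OF that] abs_divide abs_of_pos)
      qed simp
      then have "g ?y = g x / m" by (simp add: g_def sum_divide_distrib)
      then have "g q * m \<le> g x"
        using q(2)[OF \<open>?y \<in> ?Q\<close>] m by (simp add: pos_le_divide_eq)
      moreover have "g q * \<bar>x i\<bar> \<le> g q * m"
        using le[OF \<open>i \<in> N\<close>] \<open>g q > 0\<close> by (intro mult_left_mono) auto
      ultimately show ?thesis by simp
    qed
  qed
  ultimately show ?thesis unfolding g_def by blast
qed

text \<open>
  Weighting the coalition totals by the balancing weights gives \<open>x(N)\<close>. As this sum is fixed
  and every weight is positive, lower bounds on all the other totals bound each total from above.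
\<close>

lemma coalition_payoffs_bounded_if_balanced:
  fixes L :: "'a set \<Rightarrow> real"
  assumes "finite N" "finite \<A>" "\<A> \<subseteq> Pow N" and bal: "balanced N \<A>"
  shows "\<exists>C. \<forall>x :: 'a \<Rightarrow> real. sum x N = t \<longrightarrow> (\<forall>S\<in>\<A>. L S \<le> sum x S) \<longrightarrow>
    (\<forall>S\<in>\<A>. sum x S \<le> C S)"
proof -
  obtain w :: "'a set \<Rightarrow> real" where w: "\<And>S. S \<in> \<A> \<Longrightarrow> w S > 0"
    and sum_w: "\<And>i. i \<in> N \<Longrightarrow> (\<Sum>S\<in>\<A>. w S * indicat_real S i) = 1"
    using bal unfolding balanced_def by auto
  have total: "(\<Sum>S\<in>\<A>. w S * sum x S) = sum x N" for x :: "'a \<Rightarrow> real"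
  proof -
    have "(\<Sum>S\<in>\<A>. w S * sum x S) = (\<Sum>S\<in>\<A>. \<Sum>i\<in>N. w S * indicat_real S i * x i)"
    proof (rule sum.cong)
      fix S assume "S \<in> \<A>"
      then have "S \<subseteq> N" using assms(3) by auto
      then have "sum x S = (\<Sum>i\<in>N. indicat_real S i * x i)"
        using sum_indicator_times_subset[OF \<open>finite N\<close>] by metis
      then show "w S * sum x S = (\<Sum>i\<in>N. w S * indicat_real S i * x i)"
        by (simp add: sum_distrib_left mult.assoc)
    qed simp
    also have "\<dots> = (\<Sum>i\<in>N. \<Sum>S\<in>\<A>. w S * indicat_real S i * x i)" by (rule sum.swap)
    also have "\<dots> = (\<Sum>i\<in>N. (\<Sum>S\<in>\<A>. w S * indicat_real S i) * x i)"
      by (simp add: sum_distrib_right)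
    also have "\<dots> = sum x N" by (simp add: sum_w)
    finally show ?thesis .
  qed
  show ?thesis
  proof (intro exI allI impI ballI)
    fix x :: "'a \<Rightarrow> real" and T
    assume t: "sum x N = t" and L: "\<forall>S\<in>\<A>. L S \<le> sum x S" and "T \<in> \<A>"
    have "(\<Sum>S\<in>\<A> - {T}. w S * L S) \<le> (\<Sum>S\<in>\<A> - {T}. w S * sum x S)"
      using w L by (intro sum_mono mult_left_mono) (auto intro: less_imp_le)
    also have "\<dots> = t - w T * sum x T"
      using total[of x] t sum.remove[OF \<open>finite \<A>\<close> \<open>T \<in> \<A>\<close>, of "\<lambda>S. w S * sum x S"] by simp
    finally show "sum x T \<le> (t - (\<Sum>S\<in>\<A> - {T}. w S * L S)) / w T"
      using w[OF \<open>T \<in> \<A>\<close>] by (simp add: pos_le_divide_eq mult.commute)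
  qed
qed

section \<open>The prenucleolus\<close>

lemma excess_vector_eq_descending_values:
  "excess_vector N \<A> u v x =
    descending_values (\<lambda>S. u S (excess v S x)) (proper_coalitions N \<A>)"
  by (simp add: excess_vector_def descending_values_def)

lemma finite_coalitions:
  assumes "finite N" "feasible_coalitions N \<A>"
  shows "finite \<A>" "finite (proper_coalitions N \<A>)"
  using assms finite_subset[of \<A> "Pow N"]
  by (auto simp: feasible_coalitions_def proper_coalitions_def)

text \<open>
  The search is confined to the set \<open>K\<close> of preimputations whose excess utilities are all at most
  \<open>M\<close>, the largest one at the equal split \<open>x0\<close> of \<open>v(N)\<close>. It is compact, and any other
  preimputation already loses against \<open>x0\<close> at the first entry.
\<close>

lemma prenucleolus_nonempty_if_separates:
  assumes "finite N" "N \<noteq> {}" and feas: "feasible_coalitions N \<A>"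
    and bal: "balanced N \<A>" and util: "utility_function N \<A> u"
    and sep: "separates_payoffs N \<A>"
  shows "prenucleolus N \<A> u v \<noteq> {}"
proof -
  let ?P = "proper_coalitions N \<A>" and ?I = "preimputations N v"
  define E where "E = excess_vector N \<A> u v"
  define e where "e x S = u S (excess v S x)" for x S
  note fin = finite_coalitions[OF \<open>finite N\<close> feas]
  have sub: "\<A> \<subseteq> Pow N" using feas by (simp add: feasible_coalitions_def)
  have E: "E x = descending_values (e x) ?P" for x
    unfolding E_def e_def by (rule excess_vector_eq_descending_values)
  have cont: "continuous_on UNIV (\<lambda>x. e x S)" if "S \<in> ?P" for S
  proof -
    have "continuous_on UNIV (u S)" using util that by (simp add: utility_function_def)
    moreover have "continuous_on UNIV (\<lambda>x. excess v S x)"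
      unfolding excess_def by (intro continuous_on_diff continuous_on_const continuous_on_coordinate_sum)
    ultimately show ?thesis unfolding e_def by (rule continuous_on_compose2) simp
  qed
  have top: "c < E x ! 0" if "S \<in> ?P" "c < e x S" for x S c
  proof -
    have "card {S \<in> ?P. c < e x S} > 0" using that fin(2) by (auto simp: card_gt_0_iff)
    moreover have pos: "0 < card ?P" using that(1) fin(2) by (auto simp: card_gt_0_iff)
    have "c < descending_values (e x) ?P ! 0 \<longleftrightarrow> 0 < card {S \<in> ?P. c < e x S}"
      by (rule nth_descending_values_iff[OF fin(2) order_less_le_trans pos])
    ultimately show ?thesis unfolding E by simp
  qed
  define x0 where "x0 = (\<lambda>i\<in>N. v N / card N)"
  have x0: "x0 \<in> ?I"
    using assms(1,2) by (simp add: x0_def preimputations_def)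
  define M where "M = E x0 ! 0"
  define K where "K = {x \<in> ?I. \<forall>S\<in>?P. e x S \<le> M}"
  have "e x0 S \<le> M" if "S \<in> ?P" for S
    by (metis M_def less_irrefl leI top that)
  then have "x0 \<in> K" using x0 by (simp add: K_def)
  \<comment> \<open>The common range lets the bound \<open>M\<close> on utilities be pulled back to a bound \<open>m S\<close> on the
    excess of each coalition.\<close>
  have "\<exists>m. \<forall>S\<in>?P. u S (m S) = M"
  proof (intro bchoice ballI)
    fix S assume S: "S \<in> ?P"
    then have "0 < length (E x0)" using fin(2) by (auto simp: E card_gt_0_iff)
    then have "M \<in> set (E x0)" unfolding M_def by (rule nth_mem)
    then obtain T where "T \<in> ?P" "M = e x0 T"
      using fin(2) by (auto simp: E descending_values_def)
    then have "M \<in> range (u T)" by (simp add: e_def)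
    moreover have "range (u T) = range (u S)"
      using util S \<open>T \<in> ?P\<close> unfolding utility_function_def by blast
    ultimately show "\<exists>m. u S m = M" by auto
  qed
  then obtain m where m: "\<And>S. S \<in> ?P \<Longrightarrow> u S (m S) = M" by auto
  define L where "L S = (if S \<in> ?P then v S - m S else sum x0 S)" for S
  have lower: "L S \<le> sum x S" if "x \<in> K" "S \<in> \<A>" for x S
  proof (cases "S \<in> ?P")
    case True
    then have "u S (excess v S x) \<le> u S (m S)" using that(1) m by (simp add: K_def e_def)
    moreover have "strict_mono (u S)" using util True by (simp add: utility_function_def)
    ultimately have "excess v S x \<le> m S" by (simp add: strict_mono_less_eq)
    then show ?thesis using True by (simp add: L_def excess_def)
  next
    case False
    then have "S = {} \<or> S = N" using that(2) by (auto simp: proper_coalitions_def)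
    then show ?thesis using False x0 that(1) by (auto simp: L_def K_def preimputations_def)
  qed
  obtain C where C: "\<And>x S. sum x N = v N \<Longrightarrow> \<forall>S\<in>\<A>. L S \<le> sum x S \<Longrightarrow> S \<in> \<A> \<Longrightarrow> sum x S \<le> C S"
    using coalition_payoffs_bounded_if_balanced[OF \<open>finite N\<close> fin(1) sub bal, of "v N" L] by blast
  obtain \<delta> :: real where \<delta>: "\<delta> > 0" "\<And>x :: 'a \<Rightarrow> real. \<And>i. i \<in> N \<Longrightarrow> \<delta> * \<bar>x i\<bar> \<le> (\<Sum>S\<in>\<A>. \<bar>sum x S\<bar>)"
    using payoff_bound_if_separates[OF \<open>finite N\<close> fin(1) sub sep] by blast
  define R where "R = (\<Sum>S\<in>\<A>. max \<bar>L S\<bar> \<bar>C S\<bar>) / \<delta>"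
  have box: "\<bar>x i\<bar> \<le> R" if "x \<in> K" "i \<in> N" for x i
  proof -
    have "sum x N = v N" using that(1) by (simp add: K_def preimputations_def)
    then have "\<bar>sum x S\<bar> \<le> max \<bar>L S\<bar> \<bar>C S\<bar>" if "S \<in> \<A>" for S
      using lower[OF \<open>x \<in> K\<close>] C[of x S] that by fastforce
    then have "(\<Sum>S\<in>\<A>. \<bar>sum x S\<bar>) \<le> (\<Sum>S\<in>\<A>. max \<bar>L S\<bar> \<bar>C S\<bar>)"
      by (rule sum_mono)
    then have "\<bar>x i\<bar> * \<delta> \<le> (\<Sum>S\<in>\<A>. max \<bar>L S\<bar> \<bar>C S\<bar>)"
      using \<delta>(2)[OF \<open>i \<in> N\<close>, of x] by (simp add: mult.commute)
    then show ?thesis unfolding R_def using \<delta>(1) by (simp add: pos_le_divide_eq)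
  qed
  have K_eq: "K = (N \<rightarrow>\<^sub>E {-R..R}) \<inter> ({x. sum x N = v N} \<inter> (\<Inter>S\<in>?P. {x. e x S \<le> M}))"
  proof (rule Set.set_eqI)
    fix x
    have "- R \<le> x i \<and> x i \<le> R" if "x \<in> K" "i \<in> N" for i
      using box[OF that] by linarith
    then show "x \<in> K \<longleftrightarrow>
        x \<in> (N \<rightarrow>\<^sub>E {-R..R}) \<inter> ({x. sum x N = v N} \<inter> (\<Inter>S\<in>?P. {x. e x S \<le> M}))"
      by (auto simp: K_def preimputations_def PiE_iff)
  qed
  have "compact (N \<rightarrow>\<^sub>E {-R..R})" by (intro compact_PiE_fun) simp
  moreover have "closed {x. sum x N = v N}"
    by (intro closed_Collect_eq continuous_on_coordinate_sum continuous_on_const)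
  moreover have "closed {x. e x S \<le> M}" if "S \<in> ?P" for S
    using that by (intro closed_Collect_le cont continuous_on_const)
  then have "closed (\<Inter>S\<in>?P. {x. e x S \<le> M})" by (intro closed_INT ballI)
  ultimately have "compact K" unfolding K_eq by (intro compact_Int_closed closed_Int)
  moreover have "K \<noteq> {}" using \<open>x0 \<in> K\<close> by auto
  moreover have "closed {x. E x ! k \<le> c}" if "k < card ?P" for k c
    unfolding E by (intro closed_sublevel_descending_values fin(2) cont that)
  moreover have "length (E x) = card ?P" for x by (simp add: E)
  ultimately obtain x where x: "x \<in> K" "\<And>y. y \<in> K \<Longrightarrow> E x \<le>\<^sub>L E y"
    using lex_min_on_compact[of K E "card ?P"] by blast
  have "E x \<le>\<^sub>L E y" if y: "y \<in> ?I" for y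
  proof (cases "y \<in> K")
    case False
    then obtain S where S: "S \<in> ?P" "M < e y S" using y by (auto simp: K_def not_le)
    then have "M < E y ! 0" by (rule top)
    moreover have "E x ! 0 \<le> M"
      using x(2)[OF \<open>x0 \<in> K\<close>] unfolding M_def lex_le_def by (metis gr0I order.refl order_less_imp_le)
    moreover have "0 < length (E x)" using S(1) fin(2) by (auto simp: E card_gt_0_iff)
    ultimately show ?thesis unfolding lex_le_def by (intro disjI2 exI[of _ 0]) simp
  qed (rule x(2))
  then have "x \<in> prenucleolus N \<A> u v"
    using x(1) by (simp add: prenucleolus_def E_def K_def)
  then show ?thesis by blast
qed

text \<open>
  Otherwise the midpoint of the two payoff vectors, again a preimputation, would be
  lexicographically better than one of them.
\<close>

lemma prenucleolus_same_coalition_payoffs: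
  assumes "finite N" and feas: "feasible_coalitions N \<A>" and util: "utility_function N \<A> u"
    and x: "x \<in> prenucleolus N \<A> u v" and y: "y \<in> prenucleolus N \<A> u v" and "S \<in> \<A>"
  shows "sum x S = sum y S"
proof (rule ccontr)
  assume neq: "sum x S \<noteq> sum y S"
  let ?P = "proper_coalitions N \<A>" and ?I = "preimputations N v"
  let ?e = "\<lambda>x S. u S (excess v S x)"
  have I: "x \<in> ?I" "y \<in> ?I" using x y by (auto simp: prenucleolus_def)
  then have "S \<in> ?P"
    using neq \<open>S \<in> \<A>\<close> by (auto simp: proper_coalitions_def preimputations_def)
  have mono: "strict_mono (u T)" if "T \<in> ?P" for T
    using util that by (simp add: utility_function_def)
  define z where "z = (\<lambda>i\<in>N. (x i + y i) / 2)"
  have sum_z: "sum z T = (sum x T + sum y T) / 2" if "T \<subseteq> N" for T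
  proof -
    have "sum z T = (\<Sum>i\<in>T. (x i + y i) / 2)" using that by (intro sum.cong) (auto simp: z_def)
    then show ?thesis by (simp add: sum.distrib flip: sum_divide_distrib)
  qed
  have "z \<in> ?I"
    using sum_z[of N] I by (simp add: preimputations_def z_def)
  have z: "excess v T z = (excess v T x + excess v T y) / 2" if "T \<in> ?P" for T
  proof -
    have "T \<subseteq> N" using that feas by (auto simp: proper_coalitions_def feasible_coalitions_def)
    then show ?thesis using sum_z by (simp add: excess_def field_simps)
  qed
  have "\<not> descending_values (?e x) ?P \<le>\<^sub>L descending_values (?e z) ?P \<or>
      \<not> descending_values (?e y) ?P \<le>\<^sub>L descending_values (?e z) ?P"
  proof (rule midpoint_lex_improves)
    fix T assume T: "T \<in> ?P"
    show "?e z T = ?e x T" if "?e x T = ?e y T"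
      using that z[OF T] by (simp add: strict_mono_eq[OF mono[OF T]])
    show "?e z T < max (?e x T) (?e y T)" if "?e x T \<noteq> ?e y T"
      using that z[OF T] by (auto simp: less_max_iff_disj strict_mono_eq[OF mono[OF T]] strict_mono_less[OF mono[OF T]])
  next
    show "\<exists>T\<in>?P. ?e x T \<noteq> ?e y T"
      using neq \<open>S \<in> ?P\<close> by (auto simp: strict_mono_eq[OF mono] excess_def)
  qed (rule finite_coalitions[OF \<open>finite N\<close> feas])
  then show False
    using x y \<open>z \<in> ?I\<close> by (simp add: prenucleolus_def excess_vector_eq_descending_values)
qed

text \<open>
  A shift along the kernel changes no excess. Since \<open>N\<close> is itself a feasible coalition, it also
  keeps \<open>x(N)\<close> and stays among the preimputations.
\<close>

lemma prenucleolus_shift: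
  assumes feas: "feasible_coalitions N \<A>" and x: "x \<in> prenucleolus N \<A> u v"
    and d: "\<And>S. S \<in> \<A> \<Longrightarrow> sum d S = 0"
  shows "(\<lambda>i\<in>N. x i + d i) \<in> prenucleolus N \<A> u v"
proof -
  define y where "y = (\<lambda>i\<in>N. x i + d i)"
  have sum_y: "sum y S = sum x S" if "S \<in> \<A>" for S
  proof -
    have "S \<subseteq> N" using that feas by (auto simp: feasible_coalitions_def)
    then have "sum y S = (\<Sum>i\<in>S. x i + d i)" by (intro sum.cong) (auto simp: y_def)
    then show ?thesis using d[OF that] by (simp add: sum.distrib)
  qed
  have "N \<in> \<A>" using feas by (simp add: feasible_coalitions_def)
  then have "sum y N = v N"
    using x sum_y by (simp only: prenucleolus_def preimputations_def mem_Collect_eq)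
  then have "y \<in> preimputations N v"
    by (simp add: preimputations_def) (simp add: y_def)
  moreover have "excess_vector N \<A> u v y = excess_vector N \<A> u v x"
    unfolding excess_vector_def
    by (intro arg_cong[of _ _ rev] arg_cong[of _ _ sorted_list_of_multiset] image_mset_cong)
      (cases "finite (proper_coalitions N \<A>)"; simp add: excess_def sum_y proper_coalitions_def)
  ultimately show ?thesis using x by (simp add: prenucleolus_def flip: y_def)
qed

theorem theorem15:
  fixes N :: "'a set" and \<A> :: "'a set set"
    and v :: "'a set \<Rightarrow> real" and u :: "'a set \<Rightarrow> real \<Rightarrow> real"
  assumes "finite N" and "N \<noteq> {}"
    and "feasible_coalitions N \<A>"
    and "balanced N \<A>"
    and "is_game v"
    and "utility_function N \<A> u"
  shows "is_singleton (prenucleolus N \<A> u v) \<longleftrightarrow>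
    vec_space.rank (card \<A>) (coalition_matrix N \<A>) = card N"
proof -
  have "\<A> \<subseteq> Pow N" using assms(3) by (simp add: feasible_coalitions_def)
  with finite_coalitions(1)[OF assms(1,3)]
  have rank: "vec_space.rank (card \<A>) (coalition_matrix N \<A>) = card N \<longleftrightarrow> separates_payoffs N \<A>"
    by (intro rank_coalition_matrix_eq_card_iff assms(1))
  have "is_singleton (prenucleolus N \<A> u v) \<longleftrightarrow> separates_payoffs N \<A>"
  proof
    assume "is_singleton (prenucleolus N \<A> u v)"
    then obtain x where x: "prenucleolus N \<A> u v = {x}" by (auto simp: is_singleton_def)
    show "separates_payoffs N \<A>"
      unfolding separates_payoffs_def
    proof (intro allI impI ballI)
      fix d :: "'a \<Rightarrow> real" and i
      assume "\<forall>S\<in>\<A>. sum d S = 0" and "i \<in> N"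
      then have "(\<lambda>i\<in>N. x i + d i) = x"
        using prenucleolus_shift[OF assms(3), of x u v d] x by simp
      then have "x i + d i = x i" using \<open>i \<in> N\<close> by (metis restrict_apply')
      then show "d i = 0" by simp
    qed
  next
    assume sep: "separates_payoffs N \<A>"
    obtain x where x: "x \<in> prenucleolus N \<A> u v"
      using prenucleolus_nonempty_if_separates[OF assms(1-4,6) sep] by blast
    have "y = x" if y: "y \<in> prenucleolus N \<A> u v" for y
    proof -
      have "\<forall>S\<in>\<A>. (\<Sum>i\<in>S. y i - x i) = 0"
        using prenucleolus_same_coalition_payoffs[OF assms(1,3,6) y x] by (simp add: sum_subtractf)
      then have "\<forall>i\<in>N. y i - x i = 0" using sep unfolding separates_payoffs_def by blast
      then show "y = x"
        using x y by (intro extensionalityI[of _ N])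
          (auto simp: prenucleolus_def preimputations_def PiE_iff)
    qed
    with x have "prenucleolus N \<A> u v = {x}" by blast
    then show "is_singleton (prenucleolus N \<A> u v)" by simp
  qed
  with rank show ?thesis by simp
qed

end
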